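(* Let $w$ be a weight and $\Phi$ a Young function in $\Delta_2$. For every $\theta\geq 0$, there exist $\sigma\geq 0$ and $C>0$ such that the inequality $$w\left(\left\{x\in\mathbb{R}^n: M_{\Phi}^{\rho,\sigma} f(x)>\lambda\right\}\right)\leq C\int_{\mathbb{R}^n}\Phi\left(\frac{|f(x)|}{\lambda}\right)M^{\rho,\theta}w(x)\,dx$$ holds for every $\lambda>0$ and every locally integrable function $f$.
   Context: Throughout, $\rho:\mathbb{R}^n\to(0,\infty)$ is a fixed critical radius function: there are constants $C_0,N_0\ge 1$ such that $$C_0^{-1}\rho(x)\left(1+\frac{|x-y|}{\rho(x)}\right)^{-N_0}\le\rho(y)\le C_0\,\rho(x)\left(1+\frac{|x-y|}{\rho(x)}\right)^{\frac{N_0}{N_0+1}}\quad\text{for all }x,y\in\mathbb{R}^n.$$ Cubes: $Q=Q(x_0,r_0)$ denotes the cube with sides parallel to the coordinate axes, center $x_0$ and "radius" $r_0=\sqrt n\,\ell(Q)/2$, where $\ell(Q)$ is its side length. A Young function is a function $\Phi:[0,\infty)\to[0,\infty)$ that is increasing, convex, with $\Phi(0)=0$ and $\Phi(t)\to\infty$ as $t\to\infty$. $\Phi\in\Delta_2$ means there is $C>0$ with $\Phi(2t)\le C\Phi(t)$ for all $t\ge0$. For $\sigma\ge0$, $$M^{\rho,\sigma}f(x)=\sup_{Q(x_0,r_0)\ni x}\left(1+\frac{r_0}{\rho(x_0)}\right)^{-\sigma}\frac1{|Q|}\int_Q|f(y)|\,dy,\qquad M_\Phi^{\rho,\sigma}f(x)=\sup_{Q(x_0,r_0)\ni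 x}\left(1+\frac{r_0}{\rho(x_0)}\right)^{-\sigma}\|f\|_{\Phi,Q},$$ where $\|f\|_{\Phi,Q}=\inf\{\lambda>0:\frac1{|Q|}\int_Q\Phi(|f(x)|/\lambda)\,dx\le1\}$. For a measurable set $E$, $w(E)=\int_E w(x)\,dx$. *)

theory Defs
  imports "HOL-Analysis.Analysis"
begin

definition critical_radius :: "(real ^ 'n \<Rightarrow> real) \<Rightarrow> bool" where
  "critical_radius \<rho> \<longleftrightarrow>
     (\<forall>x. \<rho> x > 0) \<and>
     (\<exists>C\<^sub>0 N\<^sub>0 :: real. C\<^sub>0 \<ge> 1 \<and> N\<^sub>0 \<ge> 1 \<and>
        (\<forall>x y. inverse C\<^sub>0 * \<rho> x * (1 + norm (x - y) / \<rho> x) powr (- N\<^sub>0) \<le> \<rho> y \<and>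
               \<rho> y \<le> C\<^sub>0 * \<rho> x * (1 + norm (x - y) / \<rho> x) powr (N\<^sub>0 / (N\<^sub>0 + 1))))"

text \<open>
  Cubes are parametrised by centre and radius (half the diagonal), so that the half side length is
  the radius divided by the square root of the dimension. We take open cubes. Closed cubes give the
  same maximal functions: the boundary is a null set, and a closed cube lies in slightly larger
  concentric open ones.
\<close>

definition cube :: "real ^ 'n \<Rightarrow> real \<Rightarrow> (real ^ 'n) set" where
  "cube x\<^sub>0 r\<^sub>0 = box (\<chi> i. x\<^sub>0 $ i - r\<^sub>0 / sqrt (real CARD('n)))
                   (\<chi> i. x\<^sub>0 $ i + r\<^sub>0 / sqrt (real CARD('n)))"

definition locally_integrable :: "(real ^ 'n \<Rightarrow> real) \<Rightarrow> bool" where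
  "locally_integrable f \<longleftrightarrow> (\<forall>K. compact K \<longrightarrow> f absolutely_integrable_on K)"

definition weight :: "(real ^ 'n \<Rightarrow> real) \<Rightarrow> bool" where
  "weight w \<longleftrightarrow> (\<forall>x. w x \<ge> 0) \<and> locally_integrable w"

text \<open>
  Functions on the half line are functions on the reals whose values at negative arguments are
  irrelevant. Increasing is understood in the weak sense.
\<close>

definition young_function :: "(real \<Rightarrow> real) \<Rightarrow> bool" where
  "young_function \<Phi> \<longleftrightarrow>
     (\<forall>t\<ge>0. \<Phi> t \<ge> 0) \<and> mono_on {0..} \<Phi> \<and> convex_on {0..} \<Phi> \<and> \<Phi> 0 = 0 \<and>
     filterlim \<Phi> at_top at_top"

definition Delta2 :: "(real \<Rightarrow> real) \<Rightarrow> bool" where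
  "Delta2 \<Phi> \<longleftrightarrow> (\<exists>C>0. \<forall>t\<ge>0. \<Phi> (2 * t) \<le> C * \<Phi> t)"

text \<open>
  Averages, norms and maximal functions take values in the extended nonnegative reals; in
  particular the Luxemburg norm is infinite if no admissible \<open>s\<close> exists.
\<close>

definition average :: "(real ^ 'n) set \<Rightarrow> (real ^ 'n \<Rightarrow> real) \<Rightarrow> ennreal" where
  "average Q g = (\<integral>\<^sup>+y\<in>Q. ennreal (g y) \<partial>lebesgue) / emeasure lebesgue Q"

definition luxemburg_norm ::
    "(real \<Rightarrow> real) \<Rightarrow> (real ^ 'n) set \<Rightarrow> (real ^ 'n \<Rightarrow> real) \<Rightarrow> ennreal" where
  "luxemburg_norm \<Phi> Q f =
     Inf {ennreal s | s. s > 0 \<and> average Q (\<lambda>x. \<Phi> (\<bar>f x\<bar> / s)) \<le> 1}"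

definition maximal ::
    "(real ^ 'n \<Rightarrow> real) \<Rightarrow> real \<Rightarrow> (real ^ 'n \<Rightarrow> real) \<Rightarrow> real ^ 'n \<Rightarrow> ennreal" where
  "maximal \<rho> \<sigma> f x =
     (SUP (x\<^sub>0, r\<^sub>0) \<in> {(x\<^sub>0, r\<^sub>0). r\<^sub>0 > 0 \<and> x \<in> cube x\<^sub>0 r\<^sub>0}.
        ennreal ((1 + r\<^sub>0 / \<rho> x\<^sub>0) powr (- \<sigma>)) * average (cube x\<^sub>0 r\<^sub>0) (\<lambda>y. \<bar>f y\<bar>))"

definition maximal_Young ::
    "(real \<Rightarrow> real) \<Rightarrow> (real ^ 'n \<Rightarrow> real) \<Rightarrow> real \<Rightarrow> (real ^ 'n \<Rightarrow> real) \<Rightarrow> real ^ 'n \<Rightarrow> ennreal" where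
  "maximal_Young \<Phi> \<rho> \<sigma> f x =
     (SUP (x\<^sub>0, r\<^sub>0) \<in> {(x\<^sub>0, r\<^sub>0). r\<^sub>0 > 0 \<and> x \<in> cube x\<^sub>0 r\<^sub>0}.
        ennreal ((1 + r\<^sub>0 / \<rho> x\<^sub>0) powr (- \<sigma>)) * luxemburg_norm \<Phi> (cube x\<^sub>0 r\<^sub>0) f)"

definition weighted_measure :: "(real ^ 'n \<Rightarrow> real) \<Rightarrow> (real ^ 'n) set \<Rightarrow> ennreal" where
  "weighted_measure w E = (\<integral>\<^sup>+x\<in>E. ennreal (w x) \<partial>lebesgue)"

end

theory Submission
  imports Defs
begin

text \<open>
  Put \<open>s = (1 + r\<^sub>0 / \<rho> x\<^sub>0) powr \<theta> \<ge> 1\<close>. If a cube \<open>Q\<close> witnesses that the Young maximal function with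
  exponent \<open>\<sigma> = \<theta>\<close> exceeds \<open>lam\<close>, then the average of \<open>\<Phi> (\<bar>f\<bar> / (lam * s))\<close> over \<open>Q\<close> exceeds \<open>1\<close>, and
  convexity gives \<open>s \<cdot> |Q| \<le> \<integral>\<^sub>Q \<Phi> (\<bar>f\<bar> / lam)\<close>. Select disjoint cubes \<open>Q\<close> whose triples cover; then
  \<open>w (3Q)\<close> is at most a constant times \<open>s \<cdot> |Q|\<close> times the value of the maximal function of \<open>w\<close> at
  any point of \<open>Q\<close>, and summing over the disjoint cubes gives the claim. By the Lindelof property
  it suffices to treat finite unions of cubes, so only the finite Vitali lemma is needed.
\<close>

section \<open>Geometry and Lebesgue measure of cubes\<close>

lemma mem_cube:
  fixes x y :: "real ^ 'n"
  shows "y \<in> cube x r \<longleftrightarrow> (\<forall>i. \<bar>y $ i - x $ i\<bar> < r / sqrt (real CARD('n)))"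
  unfolding cube_def mem_box_cart by (force simp: abs_less_iff algebra_simps)

lemma open_cube: "open (cube x r)"
  unfolding cube_def by (rule open_box)

lemma cube_in_sets_lebesgue [measurable]: "cube x r \<in> sets lebesgue"
  by (metis open_cube borel_open sets_completionI_sets sets_lborel)

lemma cube_mono:
  fixes x :: "real ^ 'n"
  assumes "r \<le> r'"
  shows "cube x r \<subseteq> cube x r'"
proof
  fix y
  have "r / sqrt (real CARD('n)) \<le> r' / sqrt (real CARD('n))"
    using assms by (simp add: divide_right_mono)
  then show "y \<in> cube x r \<Longrightarrow> y \<in> cube x r'"
    unfolding mem_cube by (meson less_le_trans)
qed

lemma emeasure_cube:
  fixes x :: "real ^ 'n"
  assumes "r > 0"
  shows "emeasure lebesgue (cube x r) = ennreal ((2 * r / sqrt (real CARD('n))) ^ CARD('n))"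
proof -
  let ?h = "r / sqrt (real CARD('n))"
  let ?l = "(\<chi> i. x $ i - ?h) :: real ^ 'n" and ?u = "(\<chi> i. x $ i + ?h) :: real ^ 'n"
  have h: "?h > 0" using assms by simp
  have side: "(?u - ?l) \<bullet> b = 2 * ?h" if "b \<in> Basis" for b
    using that by (auto simp: Basis_vec_def inner_axis)
  have "?l \<bullet> b \<le> ?u \<bullet> b" if "b \<in> Basis" for b
    using side[OF that] h by (simp add: inner_diff_left)
  then have "emeasure lborel (box ?l ?u) = ennreal (\<Prod>b\<in>Basis. (?u - ?l) \<bullet> b)"
    by (simp add: emeasure_lborel_box)
  also have "(\<Prod>b\<in>Basis. (?u - ?l) \<bullet> b) = (2 * ?h) ^ CARD('n)"
    using side by simp
  finally show ?thesis unfolding cube_def by simp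
qed

lemma emeasure_cube_pos:
  fixes x :: "real ^ 'n"
  assumes "r > 0"
  shows "emeasure lebesgue (cube x r) > 0"
  unfolding emeasure_cube[OF assms] using assms by simp

lemma emeasure_cube_finite:
  fixes x :: "real ^ 'n"
  assumes "r > 0"
  shows "emeasure lebesgue (cube x r) < top"
  unfolding emeasure_cube[OF assms] using assms by simp

lemma emeasure_cube_3:
  fixes x :: "real ^ 'n"
  assumes "r > 0"
  shows "emeasure lebesgue (cube x (3 * r)) = ennreal (3 ^ CARD('n)) * emeasure lebesgue (cube x r)"
proof -
  have "(2 * (3 * r) / sqrt (real CARD('n))) ^ CARD('n)
      = 3 ^ CARD('n) * (2 * r / sqrt (real CARD('n))) ^ CARD('n)"
    by (simp flip: power_mult_distrib add: algebra_simps)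
  moreover have "3 * r > 0" using assms by simp
  ultimately show ?thesis
    using assms by (simp add: emeasure_cube ennreal_mult del: emeasure_completion)
qed

text \<open>The measure of a cube is neither zero nor infinite, so the division in
  \<open>average\<close> can be undone, even when the integral is infinite.\<close>

lemma average_cube_times_emeasure:
  assumes "r > 0"
  shows "average (cube x r) g * emeasure lebesgue (cube x r) = (\<integral>\<^sup>+y\<in>cube x r. ennreal (g y) \<partial>lebesgue)"
  using emeasure_cube_pos[OF assms, of x] emeasure_cube_finite[OF assms, of x]
  by (simp add: average_def ennreal_divide_times)

text \<open>Compare coordinates through a common point \<open>z\<close>: the path from
  \<open>x\<close> to \<open>z\<close> to \<open>x'\<close> to \<open>y\<close> costs at most three
  half sides of the larger cube.\<close>

lemma cube_subset_cube_3:
  fixes x x' :: "real ^ 'n"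
  assumes "cube x r \<inter> cube x' r' \<noteq> {}" and "r' \<le> r"
  shows "cube x' r' \<subseteq> cube x (3 * r)"
proof
  fix y assume y: "y \<in> cube x' r'"
  obtain z where z: "z \<in> cube x r" "z \<in> cube x' r'" using assms(1) by auto
  let ?n = "sqrt (real CARD('n))"
  have le: "r' / ?n \<le> r / ?n"
    using assms(2) by (simp add: divide_right_mono)
  show "y \<in> cube x (3 * r)"
    unfolding mem_cube
  proof
    fix i
    have "\<bar>y $ i - x' $ i\<bar> < r' / ?n" "\<bar>z $ i - x' $ i\<bar> < r' / ?n" "\<bar>z $ i - x $ i\<bar> < r / ?n"
      using y z by (auto simp: mem_cube)
    then have "\<bar>y $ i - x $ i\<bar> < 3 * (r / ?n)" using le by linarith
    then show "\<bar>y $ i - x $ i\<bar> < 3 * r / ?n" by simp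
  qed
qed

section \<open>The finite Vitali covering lemma\<close>

text \<open>Greedy selection: keep a cube of largest radius, drop every cube that meets it, and
  recurse on the rest. A dropped cube is no larger than the kept one it meets, hence lies in its
  triple.\<close>

lemma Vitali_finite_cubes:
  fixes F :: "((real ^ 'n) \<times> real) set"
  assumes "finite F" and "\<And>p. p \<in> F \<Longrightarrow> snd p > 0"
  obtains G where "G \<subseteq> F" "disjoint_family_on (\<lambda>p. cube (fst p) (snd p)) G"
    "(\<Union>p\<in>F. cube (fst p) (snd p)) \<subseteq> (\<Union>p\<in>G. cube (fst p) (3 * snd p))"
proof -
  have "\<exists>G\<subseteq>F. disjoint_family_on (\<lambda>p. cube (fst p) (snd p)) G \<and>
    (\<Union>p\<in>F. cube (fst p) (snd p)) \<subseteq> (\<Union>p\<in>G. cube (fst p) (3 * snd p))"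
    using assms
  proof (induction F rule: finite_psubset_induct)
    case (psubset F)
    let ?Q = "\<lambda>p :: (real ^ 'n) \<times> real. cube (fst p) (snd p)"
    let ?T = "\<lambda>p :: (real ^ 'n) \<times> real. cube (fst p) (3 * snd p)"
    show ?case
    proof (cases "F = {}")
      case True
      then show ?thesis by (auto simp: disjoint_family_on_def)
    next
      case False
      have "Max (snd ` F) \<in> snd ` F" using False psubset.hyps by simp
      then obtain p where p: "p \<in> F" "snd p = Max (snd ` F)" by force
      have max: "snd q \<le> snd p" if "q \<in> F" for q
        using that p psubset.hyps by simp
      define F' where "F' = {q \<in> F - {p}. ?Q q \<inter> ?Q p = {}}"
      have "F' \<subset> F" using p by (auto simp: F'_def)
      then obtain G where G: "G \<subseteq> F'" "disjoint_family_on ?Q G" "(\<Union>q\<in>F'. ?Q q) \<subseteq> (\<Union>q\<in>G. ?T q)"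
        using psubset.IH[of F'] psubset.prems by blast
      have "disjoint_family_on ?Q (insert p G)"
        using G(1,2) unfolding disjoint_family_on_def F'_def by blast
      moreover have "?Q q \<subseteq> (\<Union>q\<in>insert p G. ?T q)" if "q \<in> F" for q
      proof (cases "q \<in> F'")
        case True
        then show ?thesis using G(3) by blast
      next
        case False
        have "?Q q \<subseteq> ?T p"
        proof (cases "q = p")
          case True
          then show ?thesis using psubset.prems[OF p(1)] by (auto intro: cube_mono[THEN subsetD, rotated])
        next
          case False
          then have "?Q p \<inter> ?Q q \<noteq> {}" using \<open>q \<in> F\<close> \<open>q \<notin> F'\<close> by (auto simp: F'_def)
          then show ?thesis using max[OF that] by (rule cube_subset_cube_3)
        qed
        then show ?thesis by blast
      qed
      moreover have "insert p G \<subseteq> F" using p G(1) \<open>F' \<subset> F\<close> by blast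
      ultimately show ?thesis by blast
    qed
  qed
  then show ?thesis using that by blast
qed

section \<open>Measurability, and Young functions on a cube\<close>

text \<open>The function is the pointwise limit of its truncations to the balls of radius
  \<open>k\<close>, which are integrable.\<close>

lemma locally_integrable_measurable:
  fixes f :: "real ^ 'n \<Rightarrow> real"
  assumes "locally_integrable f"
  shows "f \<in> borel_measurable lebesgue"
proof (rule borel_measurable_LIMSEQ_real)
  fix x :: "real ^ 'n"
  obtain N :: nat where "norm x \<le> real N" using real_arch_simple by blast
  then have "\<forall>\<^sub>F k in sequentially. indicator (cball 0 (real k)) x *\<^sub>R f x = f x"
    by (auto simp: eventually_sequentially intro!: exI[of _ N])
  then show "(\<lambda>k. indicator (cball 0 (real k)) x *\<^sub>R f x) \<longlonglongrightarrow> f x"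
    by (rule tendsto_eventually)
next
  fix k :: nat
  have "f absolutely_integrable_on cball 0 (real k)"
    using assms by (simp add: locally_integrable_def)
  then show "(\<lambda>x. indicator (cball 0 (real k)) x *\<^sub>R f x) \<in> borel_measurable lebesgue"
    by (simp add: set_integrable_def borel_measurable_integrable)
qed

text \<open>Monotonicity is known on the half line only; composing with \<open>max 0\<close> gives a
  function monotone on all reals, hence Borel, that agrees with \<open>\<Phi>\<close> at
  \<open>\<bar>f x\<bar>\<close>.\<close>

lemma young_function_measurable:
  assumes "young_function \<Phi>" and "f \<in> borel_measurable M"
  shows "(\<lambda>x. \<Phi> (\<bar>f x\<bar>)) \<in> borel_measurable M"
proof -
  have "mono (\<lambda>t. \<Phi> (max 0 t))"
    using assms(1) by (auto simp: young_function_def mono_on_def intro!: monoI)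
  then have "(\<lambda>t. \<Phi> (max 0 t)) \<in> borel_measurable borel"
    by (rule borel_measurable_mono)
  then have "(\<lambda>x. \<Phi> (max 0 \<bar>f x\<bar>)) \<in> borel_measurable M"
    using assms(2) by (intro measurable_compose[of "\<lambda>x. \<bar>f x\<bar>" M borel "\<lambda>t. \<Phi> (max 0 t)"]) simp_all
  then show ?thesis by simp
qed

text \<open>Convexity between \<open>0\<close> and \<open>t\<close> with weight \<open>1 / s\<close>
  at \<open>t\<close>, where \<open>\<Phi> 0 = 0\<close>.\<close>

lemma young_function_divide_le:
  assumes "young_function \<Phi>" and "t \<ge> 0" and "s \<ge> 1"
  shows "\<Phi> (t / s) \<le> \<Phi> t / s"
proof -
  have "convex_on {0..} \<Phi>" and "\<Phi> 0 = 0" using assms(1) by (auto simp: young_function_def)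
  then show ?thesis
    using convex_onD[of "{0..}" \<Phi> "1 / s" 0 t] assms by simp
qed

text \<open>
  Stated with a product rather than a quotient, so that infinite integrals cause no trouble.
\<close>

lemma luxemburg_norm_gtD:
  fixes f :: "real ^ 'n \<Rightarrow> real"
  assumes Phi: "young_function \<Phi>" and f: "f \<in> borel_measurable lebesgue"
    and "r > 0" "lam > 0" "s \<ge> 1"
    and gt: "ennreal (inverse s) * luxemburg_norm \<Phi> (cube x r) f > ennreal lam"
  shows "ennreal s * emeasure lebesgue (cube x r)
    \<le> (\<integral>\<^sup>+y\<in>cube x r. ennreal (\<Phi> (\<bar>f y\<bar> / lam)) \<partial>lebesgue)" (is "_ * ?m \<le> ?I")
proof -
  let ?A = "average (cube x r) (\<lambda>y. \<Phi> (\<bar>f y\<bar> / (lam * s)))"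
  have pos: "lam * s > 0" using assms by simp
  \<comment> \<open>Otherwise \<open>lam * s\<close> would be admissible in the infimum defining the
    norm, which would then be at most \<open>lam * s\<close>.\<close>
  have "\<not> ?A \<le> 1"
  proof
    assume "?A \<le> 1"
    then have "luxemburg_norm \<Phi> (cube x r) f \<le> ennreal (lam * s)"
      unfolding luxemburg_norm_def using pos by (intro Inf_lower) blast
    then have "ennreal (inverse s) * luxemburg_norm \<Phi> (cube x r) f \<le> ennreal (inverse s) * ennreal (lam * s)"
      by (rule mult_left_mono) simp
    also have "\<dots> = ennreal lam"
      using assms by (simp flip: ennreal_mult)
    finally show False using gt by simp
  qed
  then have "1 \<le> ?A" by simp
  then have "1 * ?m \<le> ?A * ?m" by (rule mult_right_mono) simp
  also have "\<dots> = (\<integral>\<^sup>+y\<in>cube x r. ennreal (\<Phi> (\<bar>f y\<bar> / (lam * s))) \<partial>lebesgue)"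
    using \<open>r > 0\<close> by (rule average_cube_times_emeasure)
  finally have 1: "?m \<le> (\<integral>\<^sup>+y\<in>cube x r. ennreal (\<Phi> (\<bar>f y\<bar> / (lam * s))) \<partial>lebesgue)" by simp
  have [measurable]: "(\<lambda>y. \<Phi> (\<bar>f y\<bar> / lam)) \<in> borel_measurable lebesgue"
    using young_function_measurable[OF Phi, of "\<lambda>y. f y / lam"] f \<open>lam > 0\<close> by simp
  have "ennreal s * ?m \<le> ennreal s * (\<integral>\<^sup>+y\<in>cube x r. ennreal (\<Phi> (\<bar>f y\<bar> / (lam * s))) \<partial>lebesgue)"
    using 1 by (rule mult_left_mono) simp
  \<comment> \<open>Convexity gains the factor \<open>inverse s\<close>, which cancels the
    \<open>s\<close> in front.\<close>
  also have "\<dots> \<le> ennreal s * (\<integral>\<^sup>+y\<in>cube x r. ennreal (inverse s) * ennreal (\<Phi> (\<bar>f y\<bar> / lam)) \<partial>lebesgue)"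
  proof (intro mult_left_mono nn_integral_mono mult_right_mono)
    fix y
    have "\<Phi> (\<bar>f y\<bar> / lam / s) \<le> \<Phi> (\<bar>f y\<bar> / lam) / s"
      using assms by (intro young_function_divide_le[OF Phi]) auto
    then have "ennreal (\<Phi> (\<bar>f y\<bar> / (lam * s))) \<le> ennreal (inverse s * \<Phi> (\<bar>f y\<bar> / lam))"
      by (intro ennreal_leI) (simp add: field_simps)
    also have "\<dots> = ennreal (inverse s) * ennreal (\<Phi> (\<bar>f y\<bar> / lam))"
      using assms(5) by (simp add: ennreal_mult')
    finally show "ennreal (\<Phi> (\<bar>f y\<bar> / (lam * s))) \<le> ennreal (inverse s) * ennreal (\<Phi> (\<bar>f y\<bar> / lam))" .
  qed simp_all
  also have "\<dots> = ennreal s * (ennreal (inverse s) * ?I)"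
    by (subst nn_integral_cmult[symmetric]) (simp_all add: mult.assoc)
  also have "\<dots> = ?I"
    using assms(5) by (simp flip: mult.assoc ennreal_mult)
  finally show ?thesis .
qed

section \<open>Weighted measure of tripled cubes and of finite unions\<close>

text \<open>Tripling the radius about the same centre multiplies the volume by
  \<open>3 ^ CARD('n)\<close> and the power of \<open>1 + r / \<rho> x\<close> by at most
  \<open>3 powr \<theta>\<close>. The last factor is the term of the tripled cube in the maximal
  function of \<open>w\<close>.\<close>

lemma weighted_measure_cube_3_le:
  fixes w :: "real ^ 'n \<Rightarrow> real"
  assumes "\<And>x. w x \<ge> 0" and "\<rho> x > 0" and "r > 0" and "\<theta> \<ge> 0"
  shows "weighted_measure w (cube x (3 * r)) \<le>
    ennreal (3 ^ CARD('n) * 3 powr \<theta>) *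
      (ennreal ((1 + r / \<rho> x) powr \<theta>) * emeasure lebesgue (cube x r)) *
      (ennreal ((1 + 3 * r / \<rho> x) powr (- \<theta>)) * average (cube x (3 * r)) (\<lambda>y. \<bar>w y\<bar>))"
proof -
  let ?m = "emeasure lebesgue (cube x r)"
  let ?a = "average (cube x (3 * r)) (\<lambda>y. \<bar>w y\<bar>)"
  let ?k = "1 + 3 * r / \<rho> x"
  have k: "?k > 0" using assms by (simp add: add_pos_pos)
  have "weighted_measure w (cube x (3 * r)) = ?a * emeasure lebesgue (cube x (3 * r))"
    using assms(1,3) by (simp add: average_cube_times_emeasure weighted_measure_def
        del: emeasure_completion)
  also have "\<dots> = ?a * (ennreal (3 ^ CARD('n)) * ?m)"
    by (simp only: emeasure_cube_3[OF \<open>r > 0\<close>])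
  \<comment> \<open>Two mutually inverse powers of \<open>?k\<close> are inserted, one of which
    completes the term of the maximal function.\<close>
  also have "?a = ennreal (?k powr \<theta>) * (ennreal (?k powr (- \<theta>)) * ?a)"
    using k by (simp flip: mult.assoc ennreal_mult powr_add)
  also have "\<dots> \<le> ennreal (3 powr \<theta> * (1 + r / \<rho> x) powr \<theta>) * (ennreal (?k powr (- \<theta>)) * ?a)"
  proof (intro mult_right_mono ennreal_leI)
    have "?k powr \<theta> \<le> (3 * (1 + r / \<rho> x)) powr \<theta>"
      using k \<open>\<theta> \<ge> 0\<close> by (intro powr_mono2) (auto simp: algebra_simps)
    then show "?k powr \<theta> \<le> 3 powr \<theta> * (1 + r / \<rho> x) powr \<theta>"
      using assms by (simp only: powr_mult)
  qed simp
  finally have "weighted_measure w (cube x (3 * r))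
      \<le> ennreal (3 powr \<theta> * (1 + r / \<rho> x) powr \<theta>) * (ennreal (?k powr (- \<theta>)) * ?a) *
        (ennreal (3 ^ CARD('n)) * ?m)"
    by (simp add: mult_right_mono)
  then show ?thesis by (simp add: ennreal_mult mult_ac)
qed

text \<open>Makes subadditivity and continuity from below of measures available for
  \<open>weighted_measure\<close>.\<close>

lemma weighted_measure_eq_density:
  assumes "w \<in> borel_measurable lebesgue" and "A \<in> sets lebesgue"
  shows "weighted_measure w A = emeasure (density lebesgue (\<lambda>x. ennreal (w x))) A"
  using assms by (simp add: weighted_measure_def emeasure_density)

lemma weighted_measure_finite_Union_cubes:
  fixes w :: "real ^ 'n \<Rightarrow> real"
  assumes "\<And>x. w x \<ge> 0" and w: "w \<in> borel_measurable lebesgue" and "\<And>x. \<rho> x > 0" and "\<theta> \<ge> 0"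
    and F: "finite F" "\<And>p. p \<in> F \<Longrightarrow> snd p > 0"
    and g [measurable]: "g \<in> borel_measurable lebesgue"
    and le: "\<And>x r. (x, r) \<in> F \<Longrightarrow>
      ennreal ((1 + r / \<rho> x) powr \<theta>) * emeasure lebesgue (cube x r) \<le> (\<integral>\<^sup>+y\<in>cube x r. g y \<partial>lebesgue)"
  shows "weighted_measure w (\<Union>p\<in>F. cube (fst p) (snd p)) \<le>
    ennreal (3 ^ CARD('n) * 3 powr \<theta>) * (\<integral>\<^sup>+y. g y * maximal \<rho> \<theta> w y \<partial>lebesgue)"
proof -
  let ?Q = "\<lambda>p :: (real ^ 'n) \<times> real. cube (fst p) (snd p)"
  let ?T = "\<lambda>p :: (real ^ 'n) \<times> real. cube (fst p) (3 * snd p)"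
  let ?C = "ennreal (3 ^ CARD('n) * 3 powr \<theta>)"
  let ?M = "density lebesgue (\<lambda>x. ennreal (w x))"
  obtain G where G: "G \<subseteq> F" "disjoint_family_on ?Q G" "(\<Union>p\<in>F. ?Q p) \<subseteq> (\<Union>p\<in>G. ?T p)"
    using Vitali_finite_cubes[OF F] by blast
  have fin: "finite G" using G(1) F(1) by (rule finite_subset)
  \<comment> \<open>The term of the tripled cube in the maximal function of \<open>w\<close>: a
    constant below that function on all of \<open>?Q p\<close>.\<close>
  define c where "c p = ennreal ((1 + 3 * snd p / \<rho> (fst p)) powr (- \<theta>)) *
    average (?T p) (\<lambda>y. \<bar>w y\<bar>)" for p
  have c_le: "c p \<le> maximal \<rho> \<theta> w y" if "p \<in> G" "y \<in> ?Q p" for p y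
  proof -
    have r: "snd p > 0" using that(1) G(1) F(2) by blast
    then have "y \<in> ?T p" using that cube_mono[of "snd p" "3 * snd p" "fst p"] by auto
    then show ?thesis
      unfolding maximal_def c_def using r by (intro SUP_upper2[of "(fst p, 3 * snd p)"]) auto
  qed
  have T: "weighted_measure w (?T p) \<le> ?C * (\<integral>\<^sup>+y. g y * (c p * indicator (?Q p) y) \<partial>lebesgue)"
    if "p \<in> G" for p
  proof -
    have pF: "p \<in> F" "snd p > 0" using that G(1) F(2) by blast+
    let ?K = "ennreal ((1 + snd p / \<rho> (fst p)) powr \<theta>) * emeasure lebesgue (?Q p)"
    have "weighted_measure w (?T p) \<le> ?C * ?K * c p"
      unfolding c_def using assms pF by (intro weighted_measure_cube_3_le) auto
    also have "\<dots> \<le> ?C * (\<integral>\<^sup>+y\<in>?Q p. g y \<partial>lebesgue) * c p"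
      using le[of "fst p" "snd p"] pF by (intro mult_right_mono mult_left_mono) auto
    also have "\<dots> = ?C * (\<integral>\<^sup>+y. (g y * indicator (?Q p) y) * c p \<partial>lebesgue)"
      by (subst nn_integral_multc) (simp_all add: mult.assoc)
    finally show ?thesis by (simp add: mult_ac)
  qed
  have "weighted_measure w (\<Union>p\<in>F. ?Q p) \<le> emeasure ?M (\<Union>p\<in>G. ?T p)"
    using w G(3) F(1) fin
    by (subst weighted_measure_eq_density) (auto intro!: emeasure_mono sets.finite_UN)
  also have "\<dots> \<le> (\<Sum>p\<in>G. emeasure ?M (?T p))"
    using fin by (intro emeasure_subadditive_finite) auto
  also have "\<dots> \<le> (\<Sum>p\<in>G. ?C * (\<integral>\<^sup>+y. g y * (c p * indicator (?Q p) y) \<partial>lebesgue))"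
    using T w by (intro sum_mono) (simp add: weighted_measure_eq_density)
  also have "\<dots> = ?C * (\<integral>\<^sup>+y. (\<Sum>p\<in>G. g y * (c p * indicator (?Q p) y)) \<partial>lebesgue)"
    by (subst nn_integral_sum) (simp_all add: sum_distrib_left)
  \<comment> \<open>Sum and integral were exchanged while the integrands were visibly measurable;
    the maximal function enters only here, by monotonicity of the integral.\<close>
  also have "\<dots> \<le> ?C * (\<integral>\<^sup>+y. g y * maximal \<rho> \<theta> w y \<partial>lebesgue)"
  proof (intro mult_left_mono nn_integral_mono)
    fix y
    have "(\<Sum>p\<in>G. c p * indicator (?Q p) y) \<le> maximal \<rho> \<theta> w y"
    proof (cases "\<exists>q\<in>G. y \<in> ?Q q")
      case True
      then obtain q where q: "q \<in> G" "y \<in> ?Q q" by blast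
      \<comment> \<open>Disjointness of the selected cubes leaves at most one nonzero term at
        \<open>y\<close>.\<close>
      then have "(\<Sum>p\<in>G. c p * indicator (?Q p) y) = (\<Sum>p\<in>{q}. c p * indicator (?Q p) y)"
        using G(2) fin by (intro sum.mono_neutral_right) (auto simp: disjoint_family_on_def indicator_def)
      also have "\<dots> \<le> maximal \<rho> \<theta> w y"
        using q c_le by simp
      finally show ?thesis .
    next
      case False
      then show ?thesis by (simp add: indicator_def)
    qed
    then show "(\<Sum>p\<in>G. g y * (c p * indicator (?Q p) y)) \<le> g y * maximal \<rho> \<theta> w y"
      by (simp add: mult_left_mono flip: sum_distrib_left)
  qed simp
  finally show ?thesis .
qed

section \<open>From finite to arbitrary unions of open sets\<close>

text \<open>By Lindelof a countable subfamily has the same union, and the finite partial unions of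
  an enumeration increase to it, so continuity from below applies.\<close>

lemma weighted_measure_Union_open_le:
  fixes w :: "real ^ 'n \<Rightarrow> real" and Q :: "'a \<Rightarrow> (real ^ 'n) set"
  assumes w: "w \<in> borel_measurable lebesgue" and op: "\<And>p. p \<in> P \<Longrightarrow> open (Q p)"
    and le: "\<And>F. finite F \<Longrightarrow> F \<subseteq> P \<Longrightarrow> weighted_measure w (\<Union>p\<in>F. Q p) \<le> B"
  shows "weighted_measure w (\<Union>p\<in>P. Q p) \<le> B"
proof (cases "P = {}")
  case True
  then show ?thesis using le[of "{}"] by simp
next
  case False
  let ?M = "density lebesgue (\<lambda>x. ennreal (w x))"
  obtain D where D: "D \<subseteq> Q ` P" "countable D" "\<Union>D = (\<Union>p\<in>P. Q p)"
    using Lindelof[of "Q ` P"] op by auto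
  then obtain P' where P': "P' \<subseteq> P" "countable P'" "D = Q ` P'"
    using countable_subset_image[of D Q P] by auto
  obtain p0 where "p0 \<in> P" using False by blast
  \<comment> \<open>Inserting \<open>p0\<close> makes the enumerated set nonempty even if
    \<open>P'\<close> is empty; repetitions in the enumeration are harmless.\<close>
  define p where "p = from_nat_into (insert p0 P')"
  have range: "range p = insert p0 P'"
    unfolding p_def using P'(2) by (intro range_from_nat_into) auto
  have pP: "p i \<in> P" for i using rangeI[of p i] range P'(1) \<open>p0 \<in> P\<close> by auto
  have meas: "Q (p i) \<in> sets lebesgue" for i
    using op[OF pP] by (metis borel_open sets_completionI_sets sets_lborel)
  have Un: "(\<Union>p\<in>P. Q p) = (\<Union>n. \<Union>i<n. Q (p i))"
  proof
    have "(\<Union>p\<in>P. Q p) = (\<Union>p\<in>P'. Q p)" using D(3) P'(3) by simp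
    also have "\<dots> \<subseteq> (\<Union>i. Q (p i))"
      using range by (metis UN_mono image_image subset_insertI subset_refl)
    also have "\<dots> \<subseteq> (\<Union>n. \<Union>i<n. Q (p i))" by auto
    finally show "(\<Union>p\<in>P. Q p) \<subseteq> (\<Union>n. \<Union>i<n. Q (p i))" .
    show "(\<Union>n. \<Union>i<n. Q (p i)) \<subseteq> (\<Union>p\<in>P. Q p)" using pP by auto
  qed
  have "weighted_measure w (\<Union>p\<in>P. Q p) = emeasure ?M (\<Union>n. \<Union>i<n. Q (p i))"
    unfolding Un using w meas by (intro weighted_measure_eq_density) auto
  also have "\<dots> = (SUP n. emeasure ?M (\<Union>i<n. Q (p i)))"
  proof (rule SUP_emeasure_incseq[symmetric])
    show "range (\<lambda>n. \<Union>i<n. Q (p i)) \<subseteq> sets ?M" using meas by auto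
    show "incseq (\<lambda>n. \<Union>i<n. Q (p i))"
      by (intro incseq_SucI UN_mono) auto
  qed
  also have "\<dots> \<le> B"
  proof (rule SUP_least)
    fix n :: nat
    have "weighted_measure w (\<Union>q\<in>p ` {..<n}. Q q) \<le> B" using pP by (intro le) auto
    then show "emeasure ?M (\<Union>i<n. Q (p i)) \<le> B"
      using w meas by (subst weighted_measure_eq_density[symmetric]) (auto simp: image_image)
  qed
  finally show ?thesis .
qed

section \<open>The weak type estimate with \<sigma> = \<theta>\<close>

theorem theorem1p4:
  fixes \<rho> w :: "real ^ 'n \<Rightarrow> real" and \<Phi> :: "real \<Rightarrow> real"
  assumes "critical_radius \<rho>"
    and "weight w"
    and "young_function \<Phi>"
    and "Delta2 \<Phi>"
  shows "\<forall>\<theta>\<ge>0. \<exists>\<sigma>\<ge>0. \<exists>C::real. C > 0 \<and>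
    (\<forall>lam::real. \<forall>f :: real ^ 'n \<Rightarrow> real. lam > 0 \<longrightarrow> locally_integrable f \<longrightarrow>
       weighted_measure w {x. maximal_Young \<Phi> \<rho> \<sigma> f x > ennreal lam}
         \<le> ennreal C * (\<integral>\<^sup>+x. ennreal (\<Phi> (\<bar>f x\<bar> / lam)) * maximal \<rho> \<theta> w x \<partial>lebesgue))"
proof (intro allI impI)
  fix \<theta> :: real assume \<theta>: "\<theta> \<ge> 0"
  have \<rho>: "\<rho> x > 0" for x using assms(1) by (simp add: critical_radius_def)
  have w0: "w x \<ge> 0" for x using assms(2) by (simp add: weight_def)
  have w: "w \<in> borel_measurable lebesgue"
    using assms(2) by (simp add: weight_def locally_integrable_measurable)
  let ?C = "3 ^ CARD('n) * 3 powr \<theta> :: real"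
  have "weighted_measure w {x. maximal_Young \<Phi> \<rho> \<theta> f x > ennreal lam}
      \<le> ennreal ?C * (\<integral>\<^sup>+x. ennreal (\<Phi> (\<bar>f x\<bar> / lam)) * maximal \<rho> \<theta> w x \<partial>lebesgue)"
    if lam: "lam > 0" and "locally_integrable f" for lam and f :: "real ^ 'n \<Rightarrow> real"
  proof -
    have f: "f \<in> borel_measurable lebesgue"
      using that by (simp add: locally_integrable_measurable)
    have g: "(\<lambda>y. \<Phi> (\<bar>f y\<bar> / lam)) \<in> borel_measurable lebesgue"
      using young_function_measurable[OF assms(3), of "\<lambda>y. f y / lam"] f lam by simp
    define P where "P = {(x, r). r > 0 \<and>
      ennreal ((1 + r / \<rho> x) powr (- \<theta>)) * luxemburg_norm \<Phi> (cube x r) f > ennreal lam}"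
    \<comment> \<open>A cube that witnesses the inequality at one point witnesses it at all its
      points, so the level set is a union of open cubes.\<close>
    have E: "{x. maximal_Young \<Phi> \<rho> \<theta> f x > ennreal lam} = (\<Union>p\<in>P. cube (fst p) (snd p))"
      unfolding maximal_Young_def P_def by (fastforce simp: less_SUP_iff)
    have "ennreal ((1 + r / \<rho> x) powr \<theta>) * emeasure lebesgue (cube x r)
        \<le> (\<integral>\<^sup>+y\<in>cube x r. ennreal (\<Phi> (\<bar>f y\<bar> / lam)) \<partial>lebesgue)" if "(x, r) \<in> P" for x r
      \<comment> \<open>Here \<open>s\<close> is \<open>(1 + r / \<rho> x) powr \<theta>\<close>,
        which is at least \<open>1\<close> because \<theta> \<ge> 0, and whose inverse is the power
        with exponent \<open>- \<theta>\<close>.\<close>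
      using that \<rho>[of x] \<theta>
      by (intro luxemburg_norm_gtD[OF assms(3) f _ lam])
        (auto simp: P_def powr_minus ge_one_powr_ge_zero)
    then have "weighted_measure w (\<Union>p\<in>F. cube (fst p) (snd p))
        \<le> ennreal ?C * (\<integral>\<^sup>+x. ennreal (\<Phi> (\<bar>f x\<bar> / lam)) * maximal \<rho> \<theta> w x \<partial>lebesgue)"
      if "finite F" "F \<subseteq> P" for F
      using that g
      by (intro weighted_measure_finite_Union_cubes[OF w0 w \<rho> \<theta>]) (auto simp: P_def)
    then show ?thesis
      unfolding E by (rule weighted_measure_Union_open_le[OF w open_cube])
  qed
  then show "\<exists>\<sigma>\<ge>0. \<exists>C::real. C > 0 \<and>
    (\<forall>lam::real. \<forall>f :: real ^ 'n \<Rightarrow> real. lam > 0 \<longrightarrow> locally_integrable f \<longrightarrow>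
       weighted_measure w {x. maximal_Young \<Phi> \<rho> \<sigma> f x > ennreal lam}
         \<le> ennreal C * (\<integral>\<^sup>+x. ennreal (\<Phi> (\<bar>f x\<bar> / lam)) * maximal \<rho> \<theta> w x \<partial>lebesgue))"
    by - (rule exI[of _ \<theta>], rule conjI[OF \<theta>], rule exI[of _ ?C], simp)
qed

end
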